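(* Let $p\in\{0,1,2,\dots\}\cup\{\infty\}$. Then $A^p(D)=A(D)\cap C^p(\mathbb{T})$.
   Context: $D$ is the open unit disk in $\mathbb{C}$ and $\mathbb{T}=\partial D$ is the unit circle. $A(D)$ is the set of functions that are continuous on $\overline{D}$ and holomorphic in $D$. $A^p(D)$ is the set of holomorphic functions on $D$ whose derivatives $f^{(l)}$ of every order $l\in\{0,1,2,\dots\}$ with $l\le p$ extend continuously to $\overline{D}$ (such an $f$ is identified with its continuous extension to $\overline{D}$). $A(D)\cap C^p(\mathbb{T})$ denotes the set of $f\in A(D)$ such that the map $\mathbb{R}\to\mathbb{C}$, $t\mapsto f(e^{it})$, is of class $C^p$ as a function of the real variable $t$. *)

theory Defs
  imports "HOL-Complex_Analysis.Complex_Analysis" "HOL-Library.Extended_Nat"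
begin

text \<open>
  A function on the closed unit disk is represented by a total function on \<^typ>\<open>complex\<close>; its
  values outside \<^term>\<open>cball 0 1\<close> are irrelevant to membership in any of the sets below.
  Orders of smoothness range over \<^typ>\<open>enat\<close>, with \<^term>\<open>\<infinity>\<close> meaning all finite orders.
\<close>

abbreviation unit_disk :: "complex set" where
  "unit_disk \<equiv> ball 0 1"

definition extends_continuously :: "(complex \<Rightarrow> complex) \<Rightarrow> bool" where
  "extends_continuously h \<longleftrightarrow>
     (\<exists>g. continuous_on (closure unit_disk) g \<and> (\<forall>z\<in>unit_disk. g z = h z))"

definition disk_algebra :: "(complex \<Rightarrow> complex) set" where
  "disk_algebra = {f. continuous_on (closure unit_disk) f \<and> f holomorphic_on unit_disk}"

text \<open>
  Requiring \<^term>\<open>f\<close> itself to be continuous on the closed disk expresses the identification of a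
  holomorphic function with its continuous extension. The derivatives of order \<open>l \<ge> 1\<close>
  are only used on the open disk, where they do not depend on boundary values.
\<close>

definition disk_algebra_deriv :: "enat \<Rightarrow> (complex \<Rightarrow> complex) set" where
  "disk_algebra_deriv p =
     {f. f holomorphic_on unit_disk \<and> continuous_on (closure unit_disk) f \<and>
         (\<forall>l. enat l \<le> p \<longrightarrow> extends_continuously ((deriv ^^ l) f))}"

definition real_deriv :: "nat \<Rightarrow> (real \<Rightarrow> complex) \<Rightarrow> real \<Rightarrow> complex" where
  "real_deriv l h = ((\<lambda>g t. vector_derivative g (at t)) ^^ l) h"

text \<open>
  Since \<^const>\<open>vector_derivative\<close> is total, differentiability at every order below \<open>p\<close> has
  to be demanded explicitly.
\<close>

definition of_class_C :: "enat \<Rightarrow> (real \<Rightarrow> complex) \<Rightarrow> bool" where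
  "of_class_C p h \<longleftrightarrow>
     (\<forall>l. enat l < p \<longrightarrow> (\<forall>t. real_deriv l h differentiable (at t))) \<and>
     (\<forall>l. enat l \<le> p \<longrightarrow> continuous_on UNIV (real_deriv l h))"

definition circle_class_C :: "enat \<Rightarrow> (complex \<Rightarrow> complex) set" where
  "circle_class_C p = {f. of_class_C p (\<lambda>t. f (exp (\<i> * of_real t)))}"

end

theory Submission imports Defs begin

text \<open>
  By induction on the order everything reduces to one derivative: for \<open>f\<close> in the disk
  algebra, \<open>f'\<close> extends continuously to the closed disk iff the boundary function
  \<open>t \<mapsto> f (e\<^sup>i\<^sup>t)\<close> is continuously differentiable, and then its derivative is
  \<open>i e\<^sup>i\<^sup>t f' (e\<^sup>i\<^sup>t)\<close>. If \<open>f'\<close> extends, let \<open>r\<close> tend to 1 in \<open>t \<mapsto> f (r e\<^sup>i\<^sup>t)\<close>, whose derivatives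
  converge uniformly. Conversely, the rotational difference quotients
  \<open>(f (e\<^sup>i\<^sup>h z) - f z) / h\<close> lie in the disk algebra and converge uniformly on the circle as
  \<open>h\<close> tends to 0, hence on the closed disk by the maximum principle; their limit extends
  \<open>i z f' z\<close>.
\<close>

section \<open>Functions of class C on the real line\<close>

lemma of_class_C_mono: "of_class_C q h \<Longrightarrow> p \<le> q \<Longrightarrow> of_class_C p h"
  unfolding of_class_C_def by (meson order_less_le_trans order_trans)

lemma of_class_C_0: "of_class_C (enat 0) h \<longleftrightarrow> continuous_on UNIV h"
  by (auto simp: of_class_C_def real_deriv_def)

lemma real_deriv_Suc: "real_deriv (Suc l) h = real_deriv l (\<lambda>t. vector_derivative h (at t))"
  by (simp add: real_deriv_def funpow_Suc_right del: funpow.simps)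

text \<open>The recursion behind every induction over the order of smoothness.
  \<open>real_deriv_Suc\<close> peels off the innermost derivative, so naming that derivative
  \<open>h'\<close> through \<open>has_vector_derivative\<close> removes the iterated total
  operator.\<close>

lemma of_class_C_Suc:
  "of_class_C (enat (Suc n)) h \<longleftrightarrow>
     (\<exists>h'. (\<forall>t. (h has_vector_derivative h' t) (at t)) \<and> of_class_C (enat n) h')"
  (is "?L \<longleftrightarrow> ?R")
proof
  assume L: ?L
  have "h differentiable (at t)" for t
    using L[unfolded of_class_C_def, THEN conjunct1, rule_format, of 0 t]
    by (simp add: real_deriv_def)
  moreover have "of_class_C (enat n) (\<lambda>t. vector_derivative h (at t))"
    using L unfolding of_class_C_def by (auto simp flip: real_deriv_Suc)
  ultimately show ?R
    using vector_derivative_works by (intro exI[of _ "\<lambda>t. vector_derivative h (at t)"]) auto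
next
  assume ?R
  then obtain h' where h': "\<And>t. (h has_vector_derivative h' t) (at t)" "of_class_C (enat n) h'"
    by blast
  have eq: "(\<lambda>t. vector_derivative h (at t)) = h'"
    using h'(1) vector_derivative_at by blast
  have diff: "h differentiable (at t)" for t
    using h'(1) by (blast intro: differentiableI_vector)
  have cont: "continuous_on UNIV h"
    using h'(1) by (meson has_vector_derivative_continuous continuous_at_imp_continuous_on)
  have "real_deriv l h differentiable (at t)" if "enat l < enat (Suc n)" for l t
    using that h'(2) diff
    by (cases l) (auto simp: of_class_C_def real_deriv_Suc eq real_deriv_def[of 0])
  moreover have "continuous_on UNIV (real_deriv l h)" if "enat l \<le> enat (Suc n)" for l
    using that h'(2) cont
    by (cases l) (auto simp: of_class_C_def real_deriv_Suc eq real_deriv_def[of 0])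
  ultimately show ?L
    unfolding of_class_C_def by blast
qed

lemma of_class_C_add:
  "of_class_C (enat n) h \<Longrightarrow> of_class_C (enat n) k \<Longrightarrow> of_class_C (enat n) (\<lambda>t. h t + k t)"
proof (induction n arbitrary: h k)
  case 0
  then show ?case by (auto simp: of_class_C_0 intro: continuous_intros)
next
  case (Suc n)
  obtain h' k' where "\<And>t. (h has_vector_derivative h' t) (at t)" "of_class_C (enat n) h'"
    "\<And>t. (k has_vector_derivative k' t) (at t)" "of_class_C (enat n) k'"
    using Suc.prems unfolding of_class_C_Suc by blast
  then show ?case
    unfolding of_class_C_Suc
    by (intro exI[of _ "\<lambda>t. h' t + k' t"]) (auto intro: has_vector_derivative_add Suc.IH)
qed

lemma of_class_C_mult:
  "of_class_C (enat n) h \<Longrightarrow> of_class_C (enat n) k \<Longrightarrow> of_class_C (enat n) (\<lambda>t. h t * k t)"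
proof (induction n arbitrary: h k)
  case 0
  then show ?case by (auto simp: of_class_C_0 intro: continuous_intros)
next
  case (Suc n)
  obtain h' k' where *: "\<And>t. (h has_vector_derivative h' t) (at t)" "of_class_C (enat n) h'"
    "\<And>t. (k has_vector_derivative k' t) (at t)" "of_class_C (enat n) k'"
    using Suc.prems unfolding of_class_C_Suc by blast
  moreover have "of_class_C (enat n) h" "of_class_C (enat n) k"
    using Suc.prems by (auto elim: of_class_C_mono)
  ultimately show ?case
    unfolding of_class_C_Suc
    by (intro exI[of _ "\<lambda>t. h t * k' t + h' t * k t"])
      (auto intro!: has_vector_derivative_mult of_class_C_add Suc.IH)
qed

text \<open>Each differentiation multiplies the constant by \<open>a\<close>, hence the induction
  with \<open>c\<close> arbitrary. The lemma serves the factor \<open>i * e^(it)\<close> of boundary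
  derivatives and its inverse.\<close>

lemma of_class_C_exp: "of_class_C (enat n) (\<lambda>t. c * exp (a * of_real t))"
proof (induction n arbitrary: c)
  case 0
  show ?case by (auto simp: of_class_C_0 intro!: continuous_intros)
next
  case (Suc n)
  have "((\<lambda>t. c * exp (a * of_real t)) has_vector_derivative c * a * exp (a * of_real t)) (at t)"
    for t
    by (rule has_vector_derivative_real_field) (auto intro!: derivative_eq_intros)
  with Suc[of "c * a"] show ?case
    unfolding of_class_C_Suc by (intro exI conjI allI)
qed

lemma of_class_C_iff_finite: "of_class_C p h \<longleftrightarrow> (\<forall>n. enat n \<le> p \<longrightarrow> of_class_C (enat n) h)"
proof
  assume R: "\<forall>n. enat n \<le> p \<longrightarrow> of_class_C (enat n) h"
  \<comment> \<open>Class \<open>enat l\<close> does not include differentiability of the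
    \<open>l\<close>-th derivative, so order \<open>Suc l\<close> is taken; it is still at most
    \<open>p\<close>, also for infinite \<open>p\<close>.\<close>
  have "real_deriv l h differentiable (at t)" if "enat l < p" for l t
    using R[rule_format, of "Suc l"] that unfolding of_class_C_def
    by (metis Suc_ile_eq enat_ord_simps(2) lessI)
  then show "of_class_C p h"
    using R unfolding of_class_C_def by blast
qed (blast intro: of_class_C_mono)

section \<open>Boundary derivatives of functions in the disk algebra\<close>

abbreviation boundary :: "(complex \<Rightarrow> complex) \<Rightarrow> real \<Rightarrow> complex" where
  "boundary f t \<equiv> f (exp (\<i> * of_real t))"

lemma has_vector_derivative_rotation:
  assumes "f holomorphic_on unit_disk" "z \<in> unit_disk"
  shows "((\<lambda>t. f (exp (\<i> * of_real t) * z)) has_vector_derivative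
           \<i> * (exp (\<i> * of_real t) * z) * deriv f (exp (\<i> * of_real t) * z)) (at t)"
proof -
  have "exp (\<i> * of_real t) * z \<in> unit_disk"
    using assms(2) by (simp add: norm_mult)
  then have "(f has_field_derivative deriv f (exp (\<i> * of_real t) * z)) (at (exp (\<i> * of_real t) * z))"
    using assms(1) by (intro holomorphic_derivI) auto
  moreover have "((\<lambda>w. exp (\<i> * w) * z) has_field_derivative \<i> * (exp (\<i> * of_real t) * z)) (at (of_real t))"
    by (auto intro!: derivative_eq_intros)
  ultimately have "((\<lambda>w. f (exp (\<i> * w) * z)) has_field_derivative
      \<i> * (exp (\<i> * of_real t) * z) * deriv f (exp (\<i> * of_real t) * z)) (at (of_real t))"
    using DERIV_chain2 by (fastforce simp: mult.commute)
  then show ?thesis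
    by (rule has_vector_derivative_real_field)
qed

lemma boundary_has_vector_derivative:
  assumes f: "f \<in> disk_algebra"
    and g: "continuous_on (cball 0 1) g" "\<And>z. z \<in> unit_disk \<Longrightarrow> g z = deriv f z"
  shows "(boundary f has_vector_derivative \<i> * exp (\<i> * of_real t) * boundary g t) (at t)"
proof -
  have hol: "f holomorphic_on unit_disk" and cont: "continuous_on (cball 0 1) f"
    using f by (auto simp: disk_algebra_def)
  define e where "e t = exp (\<i> * of_real t)" for t :: real
  \<comment> \<open>The circles of radius \<open>r n < 1\<close> lie in the open disk, where
    \<open>g\<close> is \<open>deriv f\<close>. \<open>E\<close> is the angular derivative of
    \<open>f\<close>, written with \<open>g\<close> so that it is continuous up to the unit
    circle.\<close>
  define r where "r n = 1 - inverse (of_nat (Suc n) :: real)" for n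
  define E where "E z = \<i> * z * g z" for z
  have r_lim: "r \<longlonglongrightarrow> 1"
    unfolding r_def using tendsto_diff[OF tendsto_const LIMSEQ_inverse_real_of_nat] by fastforce
  have r: "0 \<le> r n" "r n < 1" for n
    by (auto simp: r_def field_simps)
  have norm_e: "norm (e t) = 1" for t
    by (simp add: e_def)
  have inD: "e t * of_real (r n) \<in> cball 0 1" for t n
    using r[of n] by (simp add: norm_mult norm_e)
  have ucont: "uniformly_continuous_on (cball 0 1) E"
    unfolding E_def by (intro compact_uniformly_continuous continuous_intros g(1)) auto
  have f_lim: "(\<lambda>n. f (e s * of_real (r n))) \<longlonglongrightarrow> f (e s)" for s
  proof (rule continuous_on_tendsto_compose[OF cont])
    show "(\<lambda>n. e s * of_real (r n)) \<longlonglongrightarrow> e s"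
      using tendsto_mult[OF tendsto_const tendsto_of_real[OF r_lim], of "e s"] by simp
    show "\<forall>\<^sub>F n in sequentially. e s * of_real (r n) \<in> cball 0 1"
      using inD by (intro always_eventually allI)
  qed (simp add: norm_e)
  \<comment> \<open>Termwise differentiation yields only some limit function \<open>h\<close>;
    uniqueness of limits together with \<open>f_lim\<close> later shows that it is the boundary
    function of \<open>f\<close>.\<close>
  have "\<exists>h. \<forall>s\<in>UNIV. (\<lambda>n. f (e s * of_real (r n))) \<longlonglongrightarrow> h s \<and>
      (h has_derivative (\<lambda>x. x *\<^sub>R E (e s))) (at s within UNIV)"
  proof (rule has_derivative_sequence[OF convex_UNIV])
    show "((\<lambda>t. f (e t * of_real (r n))) has_derivative (\<lambda>x. x *\<^sub>R E (e s * of_real (r n)))) (at s within UNIV)"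
      for n s
      using has_vector_derivative_rotation[OF hol, of "of_real (r n)" s] r[of n]
      by (simp add: has_vector_derivative_def e_def E_def g(2) norm_mult)
    show "\<forall>\<^sub>F n in sequentially. \<forall>s\<in>UNIV. \<forall>x. norm (x *\<^sub>R E (e s * of_real (r n)) - x *\<^sub>R E (e s)) \<le> \<epsilon> * norm x"
      if eps: "\<epsilon> > 0" for \<epsilon>
    proof -
      obtain d where d: "d > 0"
        "\<forall>z\<in>cball 0 1. \<forall>w\<in>cball 0 1. dist w z < d \<longrightarrow> dist (E w) (E z) < \<epsilon>"
        using ucont[unfolded uniformly_continuous_on_def, rule_format, OF eps] by blast
      have "\<forall>\<^sub>F n in sequentially. dist (r n) 1 < d"
        using r_lim d(1) by (auto simp: tendsto_iff)
      then show ?thesis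
      proof eventually_elim
        case (elim n)
        have "norm (E (e s * of_real (r n)) - E (e s)) \<le> \<epsilon>" for s
        proof -
          \<comment> \<open>The distance to the boundary point is \<open>1 - r n\<close>, whatever
            \<open>s\<close> is; this makes the convergence of the derivatives uniform.\<close>
          have "e s * of_real (r n) - e s = e s * of_real (r n - 1)"
            by (simp add: algebra_simps)
          then have "dist (e s * of_real (r n)) (e s) < d"
            using elim by (simp only: dist_norm norm_mult norm_e norm_of_real) simp
          then have "dist (E (e s * of_real (r n))) (E (e s)) < \<epsilon>"
            by (intro d(2)[rule_format] inD) (simp add: norm_e)
          then show ?thesis
            by (simp add: dist_norm)
        qed
        then show ?case
          by (simp add: mult.commute[of \<epsilon>] mult_left_mono flip: scaleR_diff_right)
      qed
    qed
    show "(\<lambda>n. f (e 0 * of_real (r n))) \<longlonglongrightarrow> f (e 0)"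
      by (rule f_lim)
  qed simp
  then obtain h where h: "\<And>s. (\<lambda>n. f (e s * of_real (r n))) \<longlonglongrightarrow> h s"
    "\<And>s. (h has_vector_derivative E (e s)) (at s)"
    unfolding has_vector_derivative_def by blast
  have "h s = f (e s)" for s
    using LIMSEQ_unique[OF h(1) f_lim] .
  then have "h = (\<lambda>s. f (e s))" by blast
  then show ?thesis
    using h(2)[of t] by (simp add: e_def E_def)
qed

text \<open>By the mean value inequality the error is at most the oscillation of \<open>d\<close> on
  \<open>{t..t+h}\<close>, and \<open>d\<close> is uniformly continuous on compact intervals. One
  period of \<open>t\<close> covers the circle, so periodicity of \<open>d\<close> is never invoked;
  the extra 1 in \<open>{0..2*pi+1}\<close> leaves room for \<open>t + h\<close> with
  \<open>h < 1\<close>.\<close>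

lemma difference_quotient_bound:
  fixes b :: "real \<Rightarrow> complex"
  assumes d: "\<And>t. (b has_vector_derivative d t) (at t)" "continuous_on UNIV d" and "0 < \<epsilon>"
  obtains \<delta> where "0 < \<delta>"
    "\<And>t h. t \<in> {0..2*pi} \<Longrightarrow> 0 < h \<Longrightarrow> h < \<delta> \<Longrightarrow> norm ((b (t + h) - b t) / of_real h - d t) \<le> \<epsilon>"
proof -
  have "uniformly_continuous_on {0..2*pi+1} d"
    using d(2) by (intro compact_uniformly_continuous) (auto intro: continuous_on_subset)
  then obtain \<delta> where \<delta>: "\<delta> > 0"
    "\<forall>t\<in>{0..2*pi+1}. \<forall>s\<in>{0..2*pi+1}. dist s t < \<delta> \<longrightarrow> dist (d s) (d t) < \<epsilon>"
    using \<open>0 < \<epsilon>\<close> unfolding uniformly_continuous_on_def by blast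
  show ?thesis
  proof
    show "0 < min \<delta> 1" using \<delta>(1) by simp
    fix t h :: real
    assume t: "t \<in> {0..2*pi}" and h: "0 < h" "h < min \<delta> 1"
    have "norm (b (t + h) - b t - (t + h - t) *\<^sub>R d t) \<le> norm (t + h - t) * \<epsilon>"
    proof (rule vector_differentiable_bound_linearization[where S = "{t..t+h}"])
      show "norm (d x - d t) \<le> \<epsilon>" if "x \<in> {t..t+h}" for x
        using \<delta>(2)[rule_format, of t x] that t h by (auto simp: dist_norm less_imp_le)
    qed (use h d(1) in \<open>auto simp: closed_segment_eq_real_ivl intro: has_vector_derivative_at_within\<close>)
    moreover have "(b (t + h) - b t) / of_real h - d t = (b (t + h) - b t - h *\<^sub>R d t) / of_real h"
      using h by (simp add: field_simps scaleR_conv_of_real)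
    ultimately show "norm ((b (t + h) - b t) / of_real h - d t) \<le> \<epsilon>"
      using h by (simp add: norm_divide field_simps)
  qed
qed

lemma disk_algebra_norm_le:
  assumes "f \<in> disk_algebra" "\<And>z. norm z = 1 \<Longrightarrow> norm (f z) \<le> B" "z \<in> cball 0 1"
  shows "norm (f z) \<le> B"
  by (rule maximum_modulus_frontier[of f "cball 0 1"])
    (use assms in \<open>auto simp: disk_algebra_def\<close>)

lemma deriv_extends_continuously:
  assumes f: "f \<in> disk_algebra"
    and d: "\<And>t. (boundary f has_vector_derivative d t) (at t)" "continuous_on UNIV d"
  shows "extends_continuously (deriv f)"
proof -
  have hol: "f holomorphic_on unit_disk" and cont: "continuous_on (cball 0 1) f"
    using f by (auto simp: disk_algebra_def)
  define h where "h n = inverse (of_nat (Suc n) :: real)" for n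
  \<comment> \<open>At a point \<open>e^(it)\<close> of the circle, \<open>Q n\<close> is the
    ordinary difference quotient of \<open>boundary f\<close> at \<open>t\<close> with increment
    \<open>h n\<close>.\<close>
  define Q where "Q n z = (f (exp (\<i> * of_real (h n)) * z) - f z) / of_real (h n)" for n z
  have h_lim: "h \<longlonglongrightarrow> 0"
    unfolding h_def by (rule LIMSEQ_inverse_real_of_nat)
  have h_pos: "h n > 0" for n
    by (simp add: h_def)
  have Q: "Q n \<in> disk_algebra" for n
  proof -
    have "continuous_on (cball 0 1) (Q n)"
      unfolding Q_def using h_pos[of n]
      by (intro continuous_intros cont continuous_on_compose2[OF cont]) (auto simp: norm_mult)
    moreover have "(\<lambda>z. f (exp (\<i> * of_real (h n)) * z)) holomorphic_on unit_disk"
      by (intro holomorphic_on_compose_gen[OF _ hol, unfolded o_def] holomorphic_intros)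
        (auto simp: norm_mult)
    then have "Q n holomorphic_on unit_disk"
      unfolding Q_def using h_pos[of n] by (intro holomorphic_intros hol) auto
    ultimately show ?thesis
      by (simp add: disk_algebra_def)
  qed
  \<comment> \<open>The Cauchy criterion avoids naming a limit inside the disk: on the circle
    \<open>Q m\<close> and \<open>Q n\<close> are both within a third of \<open>\<epsilon>\<close>
    of \<open>d\<close>, and the maximum principle carries the bound on their difference
    inwards.\<close>
  have "uniformly_Cauchy_on (cball 0 1) Q"
  proof (rule uniformly_Cauchy_onI)
    fix \<epsilon> :: real
    assume "\<epsilon> > 0"
    then obtain \<delta> where \<delta>: "0 < \<delta>"
      "\<And>t h. t \<in> {0..2*pi} \<Longrightarrow> 0 < h \<Longrightarrow> h < \<delta> \<Longrightarrow>
         norm ((boundary f (t + h) - boundary f t) / of_real h - d t) \<le> \<epsilon> / 3"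
      using difference_quotient_bound[OF d, of "\<epsilon> / 3"] by auto
    have "\<forall>\<^sub>F n in sequentially. h n < \<delta>"
      using h_lim \<delta>(1) by (rule order_tendstoD)
    then obtain N where N: "\<And>n. n \<ge> N \<Longrightarrow> h n < \<delta>"
      by (auto simp: eventually_sequentially)
    have "dist (Q m z) (Q n z) < \<epsilon>" if z: "z \<in> cball 0 1" and mn: "N \<le> m" "N \<le> n" for z m n
    proof -
      have "norm (Q m z - Q n z) \<le> 2 * \<epsilon> / 3"
      proof (rule disk_algebra_norm_le[of "\<lambda>z. Q m z - Q n z", OF _ _ z])
        show "(\<lambda>z. Q m z - Q n z) \<in> disk_algebra"
          using Q unfolding disk_algebra_def by (auto intro!: continuous_intros holomorphic_intros)
        fix w :: complex
        assume "norm w = 1"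
        then have w: "exp (\<i> * of_real (Arg2pi w)) = w"
          by (simp add: complex_norm_eq_1_exp)
        have bd: "norm (Q k w - d (Arg2pi w)) \<le> \<epsilon> / 3" if "N \<le> k" for k
          using \<delta>(2)[of "Arg2pi w" "h k"] h_pos[of k] N[OF that] Arg2pi[of w]
          by (simp add: Q_def w ring_distribs exp_add mult.commute)
        then show "norm (Q m w - Q n w) \<le> 2 * \<epsilon> / 3"
          using norm_triangle_le_diff[of "Q m w - d (Arg2pi w)" "Q n w - d (Arg2pi w)" "2 * \<epsilon> / 3"]
            bd[OF mn(1)] bd[OF mn(2)] by simp
      qed
      then show ?thesis
        using \<open>\<epsilon> > 0\<close> by (simp add: dist_norm)
    qed
    then show "\<exists>M. \<forall>x\<in>cball 0 1. \<forall>m\<ge>M. \<forall>n\<ge>M. dist (Q m x) (Q n x) < \<epsilon>"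
      by blast
  qed
  then obtain G where G: "uniform_limit (cball 0 1) Q G sequentially"
    using Cauchy_uniformly_convergent by (auto simp: uniformly_convergent_on_def)
  have contG: "continuous_on (cball 0 1) G"
    using Q by (intro uniform_limit_theorem[OF _ G]) (auto simp: disk_algebra_def)
  \<comment> \<open>For fixed \<open>z\<close> in the open disk, \<open>Q n z\<close> is a
    difference quotient at angle 0 of the differentiable function \<open>?F\<close>, so its limit is
    the angular derivative of \<open>f\<close> at \<open>z\<close>.\<close>
  have G_eq: "G z = \<i> * z * deriv f z" if z: "z \<in> unit_disk" for z
  proof -
    let ?D = "\<i> * z * deriv f z" and ?F = "\<lambda>t::real. f (exp (\<i> * of_real t) * z)"
    have "(?F has_vector_derivative ?D) (at 0)"
      using has_vector_derivative_rotation[OF hol z, of 0] by simp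
    then have "((\<lambda>t. norm (?F t - f z - t *\<^sub>R ?D) / norm t) \<longlongrightarrow> 0) (at 0)"
      by (simp add: has_vector_derivative_def has_derivative_at)
    moreover have "\<forall>\<^sub>F t in at 0. norm (?F t - f z - t *\<^sub>R ?D) / norm t = norm ((?F t - f z) / of_real t - ?D)"
    proof (rule eventually_mono[OF eventually_neq_at_within])
      fix t :: real
      assume "t \<noteq> 0"
      then have "(?F t - f z) / of_real t - ?D = (?F t - f z - t *\<^sub>R ?D) / of_real t"
        by (simp add: field_simps scaleR_conv_of_real)
      then show "norm (?F t - f z - t *\<^sub>R ?D) / norm t = norm ((?F t - f z) / of_real t - ?D)"
        by (simp only: norm_divide norm_of_real real_norm_def)
    qed
    ultimately have "((\<lambda>t. norm ((?F t - f z) / of_real t - ?D)) \<longlongrightarrow> 0) (at 0)"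
      by (rule Lim_transform_eventually)
    then have "((\<lambda>t. (?F t - f z) / of_real t) \<longlongrightarrow> ?D) (at 0)"
      by (simp add: Lim_null[of _ ?D] tendsto_norm_zero_iff)
    then have "(\<lambda>n. Q n z) \<longlonglongrightarrow> \<i> * z * deriv f z"
      unfolding Q_def
      by (rule filterlim_compose) (use h_lim h_pos in \<open>simp add: filterlim_at less_imp_neq[THEN not_sym]\<close>)
    moreover have "(\<lambda>n. Q n z) \<longlonglongrightarrow> G z"
      using tendsto_uniform_limitI[OF G] z by simp
    ultimately show ?thesis
      using LIMSEQ_unique by blast
  qed
  \<comment> \<open>Recovering \<open>deriv f\<close> from \<open>G\<close> requires division by
    \<open>i * z\<close>, which fails at the origin. The quotient is therefore used only away from 0
    and glued to \<open>deriv f\<close>, with which it agrees where the two regions meet; any radius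
    strictly between 0 and 1 would do.\<close>
  define k where "k z = (if 1/2 \<le> norm z then G z / (\<i> * z) else deriv f z)" for z
  define A :: "complex set" where "A = {z. 1/2 \<le> norm z \<and> norm z \<le> 1}"
  have "continuous_on (A \<union> cball 0 (1/2)) k"
    unfolding k_def
  proof (rule continuous_on_If)
    show "closed A"
      unfolding A_def by (intro closed_Collect_conj closed_Collect_le continuous_intros)
    show "continuous_on A (\<lambda>z. G z / (\<i> * z))"
      by (intro continuous_intros continuous_on_subset[OF contG]) (auto simp: A_def)
    show "continuous_on (cball 0 (1/2)) (deriv f)"
      by (rule continuous_on_subset[OF holomorphic_on_imp_continuous_on[OF holomorphic_deriv[OF hol]]])
        auto
    show "G z / (\<i> * z) = deriv f z" if "z \<in> cball 0 (1/2)" "1/2 \<le> norm z" for z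
      using that G_eq[of z] by (cases "z = 0") auto
  qed (auto simp: A_def)
  moreover have "A \<union> cball 0 (1/2) = cball 0 1"
    by (auto simp: A_def)
  moreover have "k z = deriv f z" if "z \<in> unit_disk" for z
    using that G_eq[OF that] by (auto simp: k_def)
  ultimately show ?thesis
    unfolding extends_continuously_def by (intro exI[of _ k]) simp
qed

section \<open>Induction on the order\<close>

lemma extends_continuously_cong:
  "(\<And>z. z \<in> unit_disk \<Longrightarrow> h z = k z) \<Longrightarrow> extends_continuously h \<longleftrightarrow> extends_continuously k"
  by (simp add: extends_continuously_def)

text \<open>The counterpart of \<open>of_class_C_Suc\<close>. The witness \<open>g\<close> is the
  continuous extension of \<open>deriv f\<close>; \<open>deriv f\<close> itself has no prescribed
  values on the circle and so need not be continuous on the closed disk.\<close>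

lemma disk_algebra_deriv_Suc:
  "f \<in> disk_algebra_deriv (enat (Suc n)) \<longleftrightarrow>
     f \<in> disk_algebra \<and> (\<exists>g \<in> disk_algebra_deriv (enat n). \<forall>z\<in>unit_disk. g z = deriv f z)"
  (is "?L \<longleftrightarrow> ?R")
proof -
  \<comment> \<open>Higher derivatives are local, and near a point of the open disk \<open>g\<close>
    and \<open>deriv f\<close> coincide.\<close>
  have higher: "(deriv ^^ l) g z = (deriv ^^ Suc l) f z"
    if "\<forall>z\<in>unit_disk. g z = deriv f z" "z \<in> unit_disk" for g z l
  proof -
    have "(deriv ^^ l) g z = (deriv ^^ l) (deriv f) z"
      using that eventually_nhds_in_open[of unit_disk z]
      by (intro higher_deriv_cong_ev refl) (auto elim: eventually_mono)
    then show ?thesis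
      by (simp add: funpow_Suc_right del: funpow.simps)
  qed
  show ?thesis
  proof
    assume L: ?L
    then have hol: "f holomorphic_on unit_disk" and ext: "extends_continuously ((deriv ^^ Suc 0) f)"
      by (auto simp: disk_algebra_deriv_def simp del: funpow.simps)
    then obtain g where g: "continuous_on (closure unit_disk) g" "\<forall>z\<in>unit_disk. g z = deriv f z"
      by (auto simp: extends_continuously_def)
    have "g holomorphic_on unit_disk"
      using holomorphic_transform[OF holomorphic_deriv[OF hol]] g(2) by simp
    moreover have "extends_continuously ((deriv ^^ l) g)" if "enat l \<le> enat n" for l
    proof -
      have "extends_continuously ((deriv ^^ Suc l) f)"
        using L that by (auto simp: disk_algebra_deriv_def simp del: funpow.simps)
      then show ?thesis
        using extends_continuously_cong[OF higher[OF g(2)]] by simp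
    qed
    ultimately have "g \<in> disk_algebra_deriv (enat n)"
      using g(1) by (simp add: disk_algebra_deriv_def)
    then show ?R
      using L g(2) by (auto simp: disk_algebra_deriv_def disk_algebra_def)
  next
    assume ?R
    then obtain g where f: "f \<in> disk_algebra" and g: "g \<in> disk_algebra_deriv (enat n)"
      "\<forall>z\<in>unit_disk. g z = deriv f z"
      by blast
    have "extends_continuously ((deriv ^^ l) f)" if "l \<le> Suc n" for l
    proof (cases l)
      case 0
      then show ?thesis
        using f by (auto simp: extends_continuously_def disk_algebra_def)
    next
      case (Suc m)
      then have "extends_continuously ((deriv ^^ m) g)"
        using that g(1) by (auto simp: disk_algebra_deriv_def)
      then show ?thesis
        using extends_continuously_cong[OF higher[OF g(2)]] Suc by simp
    qed
    then show ?L
      using f by (auto simp: disk_algebra_deriv_def disk_algebra_def)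
  qed
qed

lemma disk_algebra_deriv_iff_of_class_C:
  "f \<in> disk_algebra_deriv (enat n) \<longleftrightarrow> f \<in> disk_algebra \<and> of_class_C (enat n) (boundary f)"
proof (induction n arbitrary: f)
  case 0
  have "continuous_on UNIV (boundary f)" if "f \<in> disk_algebra"
    using that unfolding disk_algebra_def
    by (auto intro!: continuous_intros continuous_on_compose2[of "cball 0 1" f])
  then show ?case
    by (auto simp: of_class_C_0 disk_algebra_deriv_def disk_algebra_def extends_continuously_def)
next
  case (Suc n)
  \<comment> \<open>Multiplication by \<open>i * e^(it)\<close> is undone by multiplication by
    \<open>-i * e^(-it)\<close>, and both factors are smooth.\<close>
  have rot: "of_class_C (enat n) (\<lambda>t. \<i> * exp (\<i> * of_real t) * boundary g t) \<longleftrightarrow>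
      of_class_C (enat n) (boundary g)" for g
  proof
    assume "of_class_C (enat n) (\<lambda>t. \<i> * exp (\<i> * of_real t) * boundary g t)"
    from of_class_C_mult[OF of_class_C_exp[of n "-\<i>" "-\<i>"] this]
    show "of_class_C (enat n) (boundary g)"
      by (simp add: exp_minus field_simps)
  qed (rule of_class_C_mult[OF of_class_C_exp])
  show ?case
  proof
    assume "f \<in> disk_algebra_deriv (enat (Suc n))"
    then obtain g where f: "f \<in> disk_algebra" and g_deriv: "g \<in> disk_algebra_deriv (enat n)"
      and g_eq: "\<forall>z\<in>unit_disk. g z = deriv f z"
      unfolding disk_algebra_deriv_Suc by blast
    have g: "g \<in> disk_algebra" "of_class_C (enat n) (boundary g)"
      using g_deriv Suc.IH by simp_all
    have "(boundary f has_vector_derivative \<i> * exp (\<i> * of_real t) * boundary g t) (at t)" for t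
      using f g g_eq by (intro boundary_has_vector_derivative) (auto simp: disk_algebra_def)
    then show "f \<in> disk_algebra \<and> of_class_C (enat (Suc n)) (boundary f)"
      unfolding of_class_C_Suc using f rot[THEN iffD2, OF g(2)] by (intro conjI exI allI)
  next
    assume R: "f \<in> disk_algebra \<and> of_class_C (enat (Suc n)) (boundary f)"
    then obtain d where d: "\<And>t. (boundary f has_vector_derivative d t) (at t)"
      "of_class_C (enat n) d"
      unfolding of_class_C_Suc by blast
    then have "continuous_on UNIV d"
      using of_class_C_mono[OF d(2), of "enat 0"] by (simp add: of_class_C_0)
    then have "extends_continuously (deriv f)"
      using R d(1) deriv_extends_continuously by blast
    then obtain g where g: "continuous_on (closure unit_disk) g" "\<forall>z\<in>unit_disk. g z = deriv f z"
      by (auto simp: extends_continuously_def)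
    have "g holomorphic_on unit_disk"
      using R g(2) holomorphic_transform[OF holomorphic_deriv[of f unit_disk]]
      by (simp add: disk_algebra_def)
    then have gA: "g \<in> disk_algebra"
      using g(1) by (simp add: disk_algebra_def)
    have "(boundary f has_vector_derivative \<i> * exp (\<i> * of_real t) * boundary g t) (at t)" for t
      using R g by (intro boundary_has_vector_derivative) auto
    \<comment> \<open>Now that \<open>deriv f\<close> is known to extend, the forward formula also
      computes the given derivative \<open>d\<close>, so the smoothness of \<open>d\<close> passes
      to \<open>boundary g\<close> through \<open>rot\<close>.\<close>
    then have "d = (\<lambda>t. \<i> * exp (\<i> * of_real t) * boundary g t)"
      using d(1) vector_derivative_unique_at by blast
    then have "of_class_C (enat n) (boundary g)"
      using d(2) rot by simp
    then have "g \<in> disk_algebra_deriv (enat n)"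
      using Suc.IH gA by simp
    then show "f \<in> disk_algebra_deriv (enat (Suc n))"
      unfolding disk_algebra_deriv_Suc using R g(2) by blast
  qed
qed

lemma disk_algebra_deriv_iff_finite:
  "f \<in> disk_algebra_deriv p \<longleftrightarrow> (\<forall>n. enat n \<le> p \<longrightarrow> f \<in> disk_algebra_deriv (enat n))"
proof
  assume R: "\<forall>n. enat n \<le> p \<longrightarrow> f \<in> disk_algebra_deriv (enat n)"
  have "extends_continuously ((deriv ^^ n) f)" if "enat n \<le> p" for n
    using R that unfolding disk_algebra_deriv_def by blast
  \<comment> \<open>Order 0 is at most every \<open>p\<close> and supplies holomorphy and continuity
    of \<open>f\<close>.\<close>
  moreover have "f \<in> disk_algebra_deriv (enat 0)"
    using R[rule_format, of 0] by (simp add: enat_0)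
  ultimately show "f \<in> disk_algebra_deriv p"
    by (simp add: disk_algebra_deriv_def)
next
  assume L: "f \<in> disk_algebra_deriv p"
  have "extends_continuously ((deriv ^^ l) f)" if "enat n \<le> p" "enat l \<le> enat n" for n l
    using L order_trans[OF that(2,1)] by (simp add: disk_algebra_deriv_def)
  then show "\<forall>n. enat n \<le> p \<longrightarrow> f \<in> disk_algebra_deriv (enat n)"
    using L unfolding disk_algebra_deriv_def by blast
qed

theorem corollary2p3:
  fixes p :: enat
  shows "disk_algebra_deriv p = disk_algebra \<inter> circle_class_C p"
proof -
  \<comment> \<open>Both sides become statements about all finite orders up to \<open>p\<close>,
    which covers infinite \<open>p\<close>. The instance of order 0 pulls
    \<open>f \<in> disk_algebra\<close> out of the quantifier.\<close>
  have "f \<in> disk_algebra_deriv p \<longleftrightarrow> f \<in> disk_algebra \<and> of_class_C p (boundary f)" for f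
    unfolding disk_algebra_deriv_iff_finite[of f p] of_class_C_iff_finite[of p]
      disk_algebra_deriv_iff_of_class_C
    using enat_0 by (auto dest: spec[of _ 0])
  then show ?thesis
    by (auto simp: circle_class_C_def)
qed

end
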